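(* Let $G$ be a finite group. The following are equivalent: (i) the coprime graph $\Gamma(G)$ is a divisor graph; (ii) $\mathcal{O}_G$ is a divisor graph; (iii) $\mathcal{N}_G$ is a divisor graph.
   Context: All graphs are simple and undirected. A graph $\Gamma$ is a divisor graph if there is an injection $\alpha$ from $V(\Gamma)$ to the set of positive integers such that distinct $x,y\in V(\Gamma)$ are adjacent if and only if $\alpha(x)\mid\alpha(y)$ or $\alpha(y)\mid\alpha(x)$. The coprime graph $\Gamma(G)$ has vertex set $G$, and two distinct vertices $x,y$ are adjacent if and only if $\gcd(o(x),o(y))=1$, where $o(x)$ is the order of $x$. Let $e$ be the identity of $G$. For $a\in G$, $\pi(a)$ is the set of prime divisors of $o(a)$. For $a\in G\setminus\{e\}$ let $[a]=\{b\in G\setminus\{e\}:\pi(b)=\pi(a)\}$, and let $\widetilde{G}=\{[a]:a\in G\setminus\{e\}\}$. The graph $\mathcal{O}_G$ has vertex set $\widetilde{G}$, and $[a],[b]$ are adjacent if and only if $\pi(a)\cap\pi(b)=\emptyset$. The graph $\mathcal{N}_G$ has vertex set $\{\prod_{p\in\pi(a)}p:[a]\in\widetilde{G}\}$ (a set of positive integers), and distinct $x,y\in V(\mathcal{N}_G)$ are adjacent if and only if $\gcd(x,y)=1$. *)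

theory Defs
  imports
    "HOL-Algebra.Multiplicative_Group"
    "HOL-Computational_Algebra.Primes"
    "Graph_Theory.Pair_Digraph"
begin

text \<open>
  A simple undirected graph is a \<^locale>\<open>pair_graph\<close>: the set of arcs contains both
  orientations of every edge. That the three graphs below are of this kind is proved at the end.
  In the usual notation, \<open>coprime_graph G\<close> is \<open>\<Gamma>(G)\<close>, \<open>class_graph G\<close> is
  \<open>O\<^sub>G\<close> (on the classes \<open>[a] = prime_class G a\<close>, with \<open>\<pi>(a) = prime_divs G a\<close>), and
  \<open>radical_graph G\<close> is \<open>N\<^sub>G\<close>.
\<close>

definition divisor_graph :: "'v pair_pre_digraph \<Rightarrow> bool" where
  "divisor_graph \<Gamma> \<longleftrightarrow>
     (\<exists>\<alpha> :: 'v \<Rightarrow> nat. inj_on \<alpha> (pverts \<Gamma>) \<and> (\<forall>x\<in>pverts \<Gamma>. \<alpha> x > 0) \<and>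
        (\<forall>x\<in>pverts \<Gamma>. \<forall>y\<in>pverts \<Gamma>. x \<noteq> y \<longrightarrow>
           ((x, y) \<in> parcs \<Gamma> \<longleftrightarrow> \<alpha> x dvd \<alpha> y \<or> \<alpha> y dvd \<alpha> x)))"

definition coprime_graph :: "('a, 'm) monoid_scheme \<Rightarrow> 'a pair_pre_digraph" where
  "coprime_graph G =
     \<lparr> pverts = carrier G,
       parcs = {(x, y). x \<in> carrier G \<and> y \<in> carrier G \<and> x \<noteq> y \<and>
                        gcd (group.ord G x) (group.ord G y) = 1} \<rparr>"

definition prime_divs :: "('a, 'm) monoid_scheme \<Rightarrow> 'a \<Rightarrow> nat set" where
  "prime_divs G a = prime_factors (group.ord G a)"

definition prime_class :: "('a, 'm) monoid_scheme \<Rightarrow> 'a \<Rightarrow> 'a set" where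
  "prime_class G a = {b \<in> carrier G - {\<one>\<^bsub>G\<^esub>}. prime_divs G b = prime_divs G a}"

definition prime_classes :: "('a, 'm) monoid_scheme \<Rightarrow> 'a set set" where
  "prime_classes G = prime_class G ` (carrier G - {\<one>\<^bsub>G\<^esub>})"

definition class_graph :: "('a, 'm) monoid_scheme \<Rightarrow> 'a set pair_pre_digraph" where
  "class_graph G =
     \<lparr> pverts = prime_classes G,
       parcs = {(prime_class G a, prime_class G b) | a b.
                  a \<in> carrier G - {\<one>\<^bsub>G\<^esub>} \<and> b \<in> carrier G - {\<one>\<^bsub>G\<^esub>} \<and>
                  prime_divs G a \<inter> prime_divs G b = {}} \<rparr>"

definition radical_set :: "('a, 'm) monoid_scheme \<Rightarrow> nat set" where
  "radical_set G = (\<lambda>a. \<Prod>p\<in>prime_divs G a. p) ` (carrier G - {\<one>\<^bsub>G\<^esub>})"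

definition radical_graph :: "('a, 'm) monoid_scheme \<Rightarrow> nat pair_pre_digraph" where
  "radical_graph G =
     \<lparr> pverts = radical_set G,
       parcs = {(x, y). x \<in> radical_set G \<and> y \<in> radical_set G \<and> x \<noteq> y \<and> gcd x y = 1} \<rparr>"

lemma prime_class_eq_iff:
  assumes "a \<in> carrier G - {\<one>\<^bsub>G\<^esub>}"
  shows "prime_class G a = prime_class G b \<longleftrightarrow> prime_divs G a = prime_divs G b"
  using assms unfolding prime_class_def by auto

text \<open>Adjacency in \<^const>\<open>class_graph\<close> does not depend on the chosen representatives.\<close>

lemma class_graph_arc_iff:
  assumes "a \<in> carrier G - {\<one>\<^bsub>G\<^esub>}" and "b \<in> carrier G - {\<one>\<^bsub>G\<^esub>}"
  shows "(prime_class G a, prime_class G b) \<in> parcs (class_graph G) \<longleftrightarrow>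
         prime_divs G a \<inter> prime_divs G b = {}"
proof
  assume "(prime_class G a, prime_class G b) \<in> parcs (class_graph G)"
  then obtain c d where "prime_class G a = prime_class G c" "prime_class G b = prime_class G d"
    "prime_divs G c \<inter> prime_divs G d = {}"
    unfolding class_graph_def by auto
  then show "prime_divs G a \<inter> prime_divs G b = {}"
    using prime_class_eq_iff[OF assms(1)] prime_class_eq_iff[OF assms(2)] by simp
next
  assume "prime_divs G a \<inter> prime_divs G b = {}"
  then show "(prime_class G a, prime_class G b) \<in> parcs (class_graph G)"
    using assms unfolding class_graph_def by auto
qed

lemma prime_divs_nonempty:
  assumes "group G" and "finite (carrier G)" and "a \<in> carrier G - {\<one>\<^bsub>G\<^esub>}"
  shows "prime_divs G a \<noteq> {}"
proof -
  interpret group G by fact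
  have "ord a \<noteq> 1" using assms(3) ord_eq_1 by auto
  moreover have "ord a \<noteq> 0" using assms(2,3) ord_ge_1[of a] by auto
  ultimately show ?thesis
    unfolding prime_divs_def using prime_factor_nat[of "ord a"]
    by (auto simp: prime_factors_dvd)
qed

lemma pair_graph_coprime_graph:
  assumes "finite (carrier G)"
  shows "pair_graph (coprime_graph G)"
proof -
  have "finite (parcs (coprime_graph G))"
    by (rule finite_subset[of _ "carrier G \<times> carrier G"])
      (use assms in \<open>auto simp: coprime_graph_def\<close>)
  then show ?thesis
    using assms
    by unfold_locales
      (auto simp: coprime_graph_def symmetric_def sym_def arcs_ends_conv image_iff gcd.commute)
qed

lemma pair_graph_class_graph:
  assumes "group G" and "finite (carrier G)"
  shows "pair_graph (class_graph G)"
proof -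
  have fin: "finite (pverts (class_graph G))"
    using assms by (simp add: class_graph_def prime_classes_def)
  have wf: "parcs (class_graph G) \<subseteq> pverts (class_graph G) \<times> pverts (class_graph G)"
    by (auto simp: class_graph_def prime_classes_def)
  have fin': "finite (parcs (class_graph G))"
    using fin wf by (meson finite_SigmaI finite_subset)
  have loop: "fst e \<noteq> snd e" if "e \<in> parcs (class_graph G)" for e
  proof
    assume eq: "fst e = snd e"
    from that obtain a b where ab: "e = (prime_class G a, prime_class G b)"
      "a \<in> carrier G - {\<one>\<^bsub>G\<^esub>}" "prime_divs G a \<inter> prime_divs G b = {}"
      unfolding class_graph_def by auto
    with eq have "prime_divs G a = prime_divs G b"
      using prime_class_eq_iff[OF ab(2)] by simp
    with ab(3) prime_divs_nonempty[OF assms ab(2)] show False by simp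
  qed
  have symm: "symmetric (with_proj (class_graph G))"
    by (auto simp: class_graph_def symmetric_def sym_def arcs_ends_conv image_iff Int_commute)
  show ?thesis
    by unfold_locales (use fin fin' wf loop symm in auto)
qed

lemma pair_graph_radical_graph:
  assumes "finite (carrier G)"
  shows "pair_graph (radical_graph G)"
proof -
  have fin: "finite (radical_set G)"
    using assms by (simp add: radical_set_def)
  have "finite (parcs (radical_graph G))"
    by (rule finite_subset[of _ "radical_set G \<times> radical_set G"])
      (use fin in \<open>auto simp: radical_graph_def\<close>)
  then show ?thesis
    using fin
    by unfold_locales
      (auto simp: radical_graph_def symmetric_def sym_def arcs_ends_conv image_iff gcd.commute)
qed

end

theory Submission
  imports Defs
begin

text \<open>
  The numbers that label a divisor graph matter only through the partial order that divisibility
  puts on them. Conversely, a finite strict order is realised by divisibility of integers: give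
  each vertex a prime of its own and label it by the product of the primes of its down-set
  (\<open>divisor_graph_if_strict_order\<close>). So a finite graph is a divisor graph iff it is the
  comparability graph of a strict order.

  This class is closed under two operations. Vertices can be dropped or blown up into
  independent sets: pull the order back along the map that sends each copy to its original
  (\<open>divisor_graph_pullback\<close>). And a vertex adjacent to all others can be added: label it
  1 and double the other labels (\<open>divisor_graph_add_dominating_vertex\<close>).

  These operations relate the three graphs. Away from the identity, adjacency in the coprime
  graph of \<open>G\<close> depends only on \<open>\<pi>(a)\<close>, and elements with the same \<open>\<pi>(a)\<close> are
  not adjacent because \<open>\<pi>(a)\<close> is nonempty. The class graph and the radical graph are
  two names for the quotient, a set of primes being determined by its product. The coprime graph
  is thus this quotient with every vertex blown up to an independent set and a dominating vertex,
  the identity, added; the quotient is an induced subgraph of it. The theorem closes the cycle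
  from the class graph to the radical graph, to the coprime graph, and back.
\<close>

text \<open>
  Divisibility of the labels is inclusion of down-sets, because the prime of \<open>y\<close> divides
  the label of \<open>x\<close> exactly when \<open>y\<close> lies in the down-set of \<open>x\<close>; and
  down-sets are ordered by inclusion as their top elements are.
\<close>

lemma divisor_graph_if_strict_order:
  assumes fin: "finite (pverts \<Gamma>)"
    and asym: "asymp_on (pverts \<Gamma>) R" and trans: "transp_on (pverts \<Gamma>) R"
    and arcs: "\<And>x y. x \<in> pverts \<Gamma> \<Longrightarrow> y \<in> pverts \<Gamma> \<Longrightarrow> x \<noteq> y \<Longrightarrow>
                 (x, y) \<in> parcs \<Gamma> \<longleftrightarrow> R x y \<or> R y x"
  shows "divisor_graph \<Gamma>"
proof -
  define V where "V = pverts \<Gamma>"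
  obtain P :: "nat set" where P: "finite P" "card P = card V" "P \<subseteq> {p. prime p}"
    using infinite_arbitrarily_large[OF primes_infinite] by blast
  then obtain p where p: "bij_betw p V P"
    using fin finite_same_card_bij unfolding V_def by metis
  have prime: "prime (p y)" if "y \<in> V" for y
    using that p P(3) by (auto simp: bij_betw_def)
  have p_inj: "inj_on p V"
    using p by (simp add: bij_betw_def)
  define D where "D x = {y \<in> V. y = x \<or> R y x}" for x
  define \<alpha> where "\<alpha> x = (\<Prod>y\<in>D x. p y)" for x
  have D_fin: "finite (D x)" for x
    using fin by (simp add: D_def V_def)
  have D_sub: "D x \<subseteq> V" for x
    by (auto simp: D_def)
  have mem_D: "y \<in> D x" if y: "y \<in> V" and dvd: "p y dvd \<alpha> x" for x y
  proof -
    obtain z where z: "z \<in> D x" "p y dvd p z"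
      using dvd prime_dvd_prod_iff[OF D_fin prime[OF y]] unfolding \<alpha>_def by blast
    then have "p y = p z"
      using primes_dvd_imp_eq[of "p y" "p z"] prime[OF y] prime[of z] D_sub[of x] by blast
    then show ?thesis
      using inj_onD[OF p_inj, of y z] y z(1) D_sub[of x] by blast
  qed
  have dvd_iff: "\<alpha> x dvd \<alpha> y \<longleftrightarrow> x = y \<or> R x y" if x: "x \<in> V" and y: "y \<in> V" for x y
  proof
    assume "\<alpha> x dvd \<alpha> y"
    moreover have "p x dvd \<alpha> x"
      unfolding \<alpha>_def using x by (intro dvd_prodI D_fin) (simp add: D_def)
    ultimately show "x = y \<or> R x y"
      using mem_D[OF x, of y] dvd_trans[of "p x" "\<alpha> x" "\<alpha> y"] by (auto simp: D_def)
  next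
    assume "x = y \<or> R x y"
    then have "D x \<subseteq> D y"
      using x y trans by (auto simp: D_def V_def dest: transp_onD)
    then show "\<alpha> x dvd \<alpha> y"
      unfolding \<alpha>_def by (intro prod_dvd_prod_subset D_fin)
  qed
  have "inj_on \<alpha> V"
  proof (rule inj_onI)
    fix x y assume *: "x \<in> V" "y \<in> V" "\<alpha> x = \<alpha> y"
    then have "x = y \<or> R x y" "y = x \<or> R y x"
      using dvd_iff[of x y] dvd_iff[of y x] by simp_all
    then show "x = y"
      using asym * by (auto simp: V_def dest: asymp_onD)
  qed
  moreover have "\<alpha> x > 0" for x
    unfolding \<alpha>_def using prime D_sub[of x] by (intro prod_pos) (blast intro: prime_gt_0_nat)
  ultimately show ?thesis
    unfolding divisor_graph_def using dvd_iff arcs by (intro exI[of _ \<alpha>]) (auto simp: V_def)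
qed

text \<open>
  Divisibility on \<open>\<Gamma>\<close> pulls back only to a preorder, since the points of a fibre of
  \<open>f\<close> inherit the same label; making each fibre an antichain turns it into a strict order,
  whose realisation supplies distinct labels. With \<open>f\<close> injective this is the case of an
  induced subgraph.
\<close>

lemma divisor_graph_pullback:
  assumes \<Gamma>: "divisor_graph \<Gamma>"
    and fin: "finite (pverts \<Delta>)"
    and f: "\<And>x. x \<in> pverts \<Delta> \<Longrightarrow> f x \<in> pverts \<Gamma>"
    and arcs: "\<And>x y. x \<in> pverts \<Delta> \<Longrightarrow> y \<in> pverts \<Delta> \<Longrightarrow> x \<noteq> y \<Longrightarrow>
                 (x, y) \<in> parcs \<Delta> \<longleftrightarrow> f x \<noteq> f y \<and> (f x, f y) \<in> parcs \<Gamma>"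
  shows "divisor_graph \<Delta>"
proof -
  obtain \<alpha> :: "'a \<Rightarrow> nat" where inj: "inj_on \<alpha> (pverts \<Gamma>)"
    and \<alpha>: "\<And>x y. x \<in> pverts \<Gamma> \<Longrightarrow> y \<in> pverts \<Gamma> \<Longrightarrow> x \<noteq> y \<Longrightarrow>
            (x, y) \<in> parcs \<Gamma> \<longleftrightarrow> \<alpha> x dvd \<alpha> y \<or> \<alpha> y dvd \<alpha> x"
    using \<Gamma> unfolding divisor_graph_def by blast
  define R where "R x y \<longleftrightarrow> f x \<noteq> f y \<and> \<alpha> (f x) dvd \<alpha> (f y)" for x y
  have antisym: "f x = f y" if "x \<in> pverts \<Delta>" "y \<in> pverts \<Delta>"
    "\<alpha> (f x) dvd \<alpha> (f y)" "\<alpha> (f y) dvd \<alpha> (f x)" for x y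
    using that f inj by (metis dvd_antisym inj_onD)
  show ?thesis
  proof (rule divisor_graph_if_strict_order[OF fin, of R])
    show "asymp_on (pverts \<Delta>) R"
      using antisym by (auto simp: R_def intro!: asymp_onI)
    show "transp_on (pverts \<Delta>) R"
    proof (rule transp_onI)
      fix x y z assume *: "x \<in> pverts \<Delta>" "y \<in> pverts \<Delta>" "z \<in> pverts \<Delta>" "R x y" "R y z"
      then have "f x \<noteq> f z"
        using antisym[of x y] by (auto simp: R_def)
      then show "R x z"
        using * unfolding R_def by (blast intro: dvd_trans)
    qed
    show "(x, y) \<in> parcs \<Delta> \<longleftrightarrow> R x y \<or> R y x"
      if "x \<in> pverts \<Delta>" "y \<in> pverts \<Delta>" "x \<noteq> y" for x y
      using arcs[OF that] \<alpha>[of "f x" "f y"] f that unfolding R_def by auto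
  qed
qed

lemma divisor_graph_add_dominating_vertex:
  assumes "divisor_graph \<lparr>pverts = V - {z}, parcs = A\<rparr>"
    and dom: "\<And>x. x \<in> V \<Longrightarrow> x \<noteq> z \<Longrightarrow> (x, z) \<in> A \<and> (z, x) \<in> A"
  shows "divisor_graph \<lparr>pverts = V, parcs = A\<rparr>"
proof -
  obtain \<alpha> :: "'a \<Rightarrow> nat" where inj: "inj_on \<alpha> (V - {z})" and pos: "\<And>x. x \<in> V - {z} \<Longrightarrow> \<alpha> x > 0"
    and \<alpha>: "\<And>x y. x \<in> V - {z} \<Longrightarrow> y \<in> V - {z} \<Longrightarrow> x \<noteq> y \<Longrightarrow>
            (x, y) \<in> A \<longleftrightarrow> \<alpha> x dvd \<alpha> y \<or> \<alpha> y dvd \<alpha> x"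
    using assms(1) unfolding divisor_graph_def by auto
  \<comment> \<open>Doubling frees the label 1, which \<open>\<alpha>\<close> may already use.\<close>
  define \<beta> where "\<beta> x = (if x = z then 1 else 2 * \<alpha> x)" for x
  have "inj_on \<beta> V"
  proof (rule inj_onI)
    fix x y assume "x \<in> V" "y \<in> V" "\<beta> x = \<beta> y"
    then show "x = y"
      using inj_onD[OF inj, of x y] by (auto simp: \<beta>_def split: if_splits)
  qed
  moreover have "\<beta> x > 0" if "x \<in> V" for x
    using pos that by (simp add: \<beta>_def)
  moreover have "(x, y) \<in> A \<longleftrightarrow> \<beta> x dvd \<beta> y \<or> \<beta> y dvd \<beta> x" if "x \<in> V" "y \<in> V" "x \<noteq> y" for x y
    using \<alpha>[of x y] dom that by (auto simp: \<beta>_def)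
  ultimately show ?thesis
    unfolding divisor_graph_def by (intro exI[of _ \<beta>]) auto
qed

lemma coprime_iff_disjoint_prime_factors:
  fixes m n :: nat
  assumes "m > 0" "n > 0"
  shows "gcd m n = 1 \<longleftrightarrow> prime_factors m \<inter> prime_factors n = {}"
proof
  assume "gcd m n = 1"
  then show "prime_factors m \<inter> prime_factors n = {}"
    by (metis disjoint_iff gcd_greatest in_prime_factors_iff not_prime_unit)
next
  assume *: "prime_factors m \<inter> prime_factors n = {}"
  show "gcd m n = 1"
  proof (rule ccontr)
    assume "gcd m n \<noteq> 1"
    then obtain p where "prime p" "p dvd gcd m n"
      using prime_factor_nat by blast
    with * assms show False
      by (auto simp: prime_factors_dvd)
  qed
qed

lemma prime_factors_prod_primes:
  fixes S :: "nat set"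
  assumes "finite S" "\<And>p. p \<in> S \<Longrightarrow> prime p"
  shows "prime_factors (\<Prod>S) = S"
proof -
  have pos: "\<Prod>S > 0"
    using assms by (intro prod_pos) (auto intro: prime_gt_0_nat)
  show ?thesis
  proof (intro equalityI subsetI)
    fix p assume "p \<in> prime_factors (\<Prod>S)"
    then have "prime p" "p dvd \<Prod>S" by (auto simp: in_prime_factors_iff)
    then obtain q where "q \<in> S" "p dvd q"
      using prime_dvd_prod_iff[OF assms(1), of p "\<lambda>x. x"] by auto
    then show "p \<in> S"
      using assms(2) \<open>prime p\<close> primes_dvd_imp_eq by blast
  next
    fix p assume "p \<in> S"
    then show "p \<in> prime_factors (\<Prod>S)"
      using assms pos dvd_prodI[OF assms(1), of p "\<lambda>x. x"] by (auto simp: in_prime_factors_iff)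
  qed
qed

lemma prime_factors_prod_prime_divs: "prime_factors (\<Prod>(prime_divs G a)) = prime_divs G a"
  by (rule prime_factors_prod_primes) (auto simp: prime_divs_def)

lemma gcd_prod_prime_divs_eq_1_iff:
  "gcd (\<Prod>(prime_divs G a)) (\<Prod>(prime_divs G b)) = 1 \<longleftrightarrow> prime_divs G a \<inter> prime_divs G b = {}"
proof -
  have "\<Prod>(prime_divs G c) > 0" for c
    by (intro prod_pos) (auto simp: prime_divs_def in_prime_factors_iff intro: prime_gt_0_nat)
  then show ?thesis
    by (simp only: coprime_iff_disjoint_prime_factors prime_factors_prod_prime_divs)
qed

lemma (in group) gcd_ord_eq_1_iff:
  assumes "finite (carrier G)" "a \<in> carrier G" "b \<in> carrier G"
  shows "gcd (ord a) (ord b) = 1 \<longleftrightarrow> prime_divs G a \<inter> prime_divs G b = {}"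
  unfolding prime_divs_def
  using assms ord_ge_1[of a] ord_ge_1[of b] by (intro coprime_iff_disjoint_prime_factors) auto

text \<open>
  A radical and the class it comes from carry the same set of primes, so choosing an element with
  a given radical embeds the radical graph into the class graph.
\<close>

lemma divisor_graph_radical_if_class:
  assumes G: "group G" "finite (carrier G)" and "divisor_graph (class_graph G)"
  shows "divisor_graph (radical_graph G)"
proof -
  define V where "V = carrier G - {\<one>\<^bsub>G\<^esub>}"
  define r where "r = inv_into V (\<lambda>a. \<Prod>(prime_divs G a))"
  have r: "r n \<in> V" "\<Prod>(prime_divs G (r n)) = n" if "n \<in> radical_set G" for n
    using that inv_into_into[of n _ V] f_inv_into_f[of n _ V]
    unfolding radical_set_def r_def V_def by fast+
  show ?thesis
  proof (rule divisor_graph_pullback[OF assms(3), of _ "\<lambda>n. prime_class G (r n)"])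
    show "finite (pverts (radical_graph G))"
      using G by (simp add: radical_graph_def radical_set_def)
    show "prime_class G (r n) \<in> pverts (class_graph G)" if "n \<in> pverts (radical_graph G)" for n
      using r that by (simp add: class_graph_def prime_classes_def radical_graph_def V_def)
  next
    fix m n assume "m \<in> pverts (radical_graph G)" "n \<in> pverts (radical_graph G)" "m \<noteq> n"
    then have mn: "m \<in> radical_set G" "n \<in> radical_set G" "m \<noteq> n"
      by (simp_all add: radical_graph_def)
    then have "prime_divs G (r m) \<noteq> prime_divs G (r n)"
      using r by metis
    then have "prime_class G (r m) \<noteq> prime_class G (r n)"
      using prime_class_eq_iff[of "r m" G "r n"] r(1)[OF mn(1)] unfolding V_def by blast
    moreover have "(m, n) \<in> parcs (radical_graph G) \<longleftrightarrow>
        prime_divs G (r m) \<inter> prime_divs G (r n) = {}"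
      using mn gcd_prod_prime_divs_eq_1_iff[of G "r m" "r n"] r by (simp add: radical_graph_def)
    ultimately show "(m, n) \<in> parcs (radical_graph G) \<longleftrightarrow>
        prime_class G (r m) \<noteq> prime_class G (r n) \<and>
        (prime_class G (r m), prime_class G (r n)) \<in> parcs (class_graph G)"
      using class_graph_arc_iff[of "r m" G "r n"] r(1) mn unfolding V_def by blast
  qed
qed

text \<open>
  The blow-up step. The identity is set apart because its order is 1: it has the empty set of
  primes, hence no radical in the quotient, and it is coprime to every element.
\<close>

lemma divisor_graph_coprime_if_radical:
  assumes G: "group G" "finite (carrier G)" and "divisor_graph (radical_graph G)"
  shows "divisor_graph (coprime_graph G)"
proof -
  interpret group G by fact
  have "divisor_graph \<lparr>pverts = carrier G - {\<one>\<^bsub>G\<^esub>}, parcs = parcs (coprime_graph G)\<rparr>"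
    (is "divisor_graph ?\<Delta>")
  proof (rule divisor_graph_pullback[OF assms(3), of _ "\<lambda>a. \<Prod>(prime_divs G a)"])
    show "finite (pverts ?\<Delta>)"
      using G by simp
    show "\<Prod>(prime_divs G a) \<in> pverts (radical_graph G)" if "a \<in> pverts ?\<Delta>" for a
      using that by (simp add: radical_graph_def radical_set_def)
  next
    fix a b assume "a \<in> pverts ?\<Delta>" "b \<in> pverts ?\<Delta>" "a \<noteq> b"
    then have ab: "a \<in> carrier G - {\<one>\<^bsub>G\<^esub>}" "b \<in> carrier G - {\<one>\<^bsub>G\<^esub>}" "a \<noteq> b"
      by simp_all
    have "(a, b) \<in> parcs ?\<Delta> \<longleftrightarrow> prime_divs G a \<inter> prime_divs G b = {}"
      using ab gcd_ord_eq_1_iff[OF G(2), of a b] by (simp add: coprime_graph_def)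
    \<comment> \<open>Disjoint nonempty sets of primes differ, so adjacent elements have different radicals.\<close>
    moreover have "\<Prod>(prime_divs G a) \<noteq> \<Prod>(prime_divs G b)" if "prime_divs G a \<inter> prime_divs G b = {}"
      using that prime_divs_nonempty[OF G ab(1)] prime_factors_prod_prime_divs by (metis Int_absorb)
    ultimately show "(a, b) \<in> parcs ?\<Delta> \<longleftrightarrow> \<Prod>(prime_divs G a) \<noteq> \<Prod>(prime_divs G b) \<and>
        (\<Prod>(prime_divs G a), \<Prod>(prime_divs G b)) \<in> parcs (radical_graph G)"
      using gcd_prod_prime_divs_eq_1_iff[of G a b] ab
      by (auto simp: radical_graph_def radical_set_def)
  qed
  then have "divisor_graph \<lparr>pverts = carrier G, parcs = parcs (coprime_graph G)\<rparr>"
    by (rule divisor_graph_add_dominating_vertex) (auto simp: coprime_graph_def)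
  then show ?thesis
    by (simp add: coprime_graph_def)
qed

text \<open>A system of representatives of the classes induces a copy of the class graph.\<close>

lemma divisor_graph_class_if_coprime:
  assumes G: "group G" "finite (carrier G)" and "divisor_graph (coprime_graph G)"
  shows "divisor_graph (class_graph G)"
proof -
  interpret group G by fact
  define V where "V = carrier G - {\<one>\<^bsub>G\<^esub>}"
  define r where "r = inv_into V (prime_class G)"
  have r: "r C \<in> V" "prime_class G (r C) = C" if "C \<in> prime_classes G" for C
    using that inv_into_into[of C _ V] f_inv_into_f[of C _ V]
    unfolding prime_classes_def r_def V_def by fast+
  show ?thesis
  proof (rule divisor_graph_pullback[OF assms(3), of _ r])
    show "finite (pverts (class_graph G))"
      using G by (simp add: class_graph_def prime_classes_def)
    show "r C \<in> pverts (coprime_graph G)" if "C \<in> pverts (class_graph G)" for C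
      using r that by (simp add: class_graph_def coprime_graph_def V_def)
  next
    fix C D assume "C \<in> pverts (class_graph G)" "D \<in> pverts (class_graph G)" "C \<noteq> D"
    then have CD: "C \<in> prime_classes G" "D \<in> prime_classes G" "C \<noteq> D"
      by (simp_all add: class_graph_def)
    then have "r C \<noteq> r D"
      using r by metis
    moreover have "(C, D) \<in> parcs (class_graph G) \<longleftrightarrow> prime_divs G (r C) \<inter> prime_divs G (r D) = {}"
      using class_graph_arc_iff[of "r C" G "r D"] r CD unfolding V_def by simp
    ultimately show "(C, D) \<in> parcs (class_graph G) \<longleftrightarrow>
        r C \<noteq> r D \<and> (r C, r D) \<in> parcs (coprime_graph G)"
      using gcd_ord_eq_1_iff[OF G(2), of "r C" "r D"] r(1) CD
      by (simp add: coprime_graph_def V_def)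
  qed
qed

theorem theorem4p3:
  fixes G :: "('a, 'm) monoid_scheme"
  assumes "group G" and "finite (carrier G)"
  shows "(divisor_graph (coprime_graph G) \<longleftrightarrow> divisor_graph (class_graph G)) \<and>
         (divisor_graph (class_graph G) \<longleftrightarrow> divisor_graph (radical_graph G))"
  using divisor_graph_radical_if_class[OF assms] divisor_graph_coprime_if_radical[OF assms]
    divisor_graph_class_if_coprime[OF assms] by blast

end
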